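(* There exists a reiteratively hypercyclic weighted shift on $c_0(\mathbb{Z}_+)$ that is not $\mathfrak{U}$-frequently hypercyclic.
   Context: $\mathbb{Z}_+$ is the set of non-negative integers and $(e_n)_{n\ge0}$ is the canonical basis of $c_0(\mathbb{Z}_+)$. For a bounded sequence $w=(w_n)_{n\ge1}$ of non-zero scalars, the weighted (backward) shift $B_w$ on $c_0(\mathbb{Z}_+)$ is the operator with $B_we_0=0$ and $B_we_n=w_ne_{n-1}$ for $n\ge1$. For $A\subseteq\mathbb{Z}_+$: the upper density is $\overline{d}(A)=\limsup_{k\to\infty}|A\cap[0,k]|/k$; the upper Banach density is $\overline{Bd}(A)=\lim_{s\to\infty}\alpha^s/s$, where $\alpha^s=\limsup_{k\to\infty}|A\cap[k+1,k+s]|$ (the limit always exists). For a continuous linear operator $T$ on $X$, $x\in X$ and $V\subset X$, $N(x,V)=\{n\ge0:T^nx\in V\}$. $T$ is $\mathfrak{U}$-frequently hypercyclic if there exists $x\in X$ such that $\overline{d}(N(x,V))>0$ for every non-empty open $V\subset X$; $T$ is reiteratively hypercyclic if there exists $x\in X$ such that $\overline{Bd}(N(x,V))>0$ for every non-empty open $V\subset X$. *)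

theory Defs
  imports "HOL-Analysis.Analysis"
begin

typedef (overloaded) 'a c0 = "{x :: nat \<Rightarrow> 'a::real_normed_vector. x \<longlonglongrightarrow> 0}"
  morphisms c0_nth Abs_c0
  by (auto intro!: exI[of _ "\<lambda>_. 0"])

setup_lifting type_definition_c0

lemma c0_nth_tendsto: "c0_nth x \<longlonglongrightarrow> 0"
  using c0_nth[of x] by simp

lemma c0_eqI: "(\<And>n. c0_nth x n = c0_nth y n) \<Longrightarrow> x = y"
  by (metis c0_nth_inject ext)

lemma c0_bdd_above: "bdd_above (range (\<lambda>n. norm (c0_nth x n)))"
proof -
  have "Bseq (c0_nth x)"
    using c0_nth_tendsto convergentI convergent_imp_Bseq by blast
  then show ?thesis
    by (metis Bseq_eq_bounded bdd_above_norm image_image)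
qed

instantiation c0 :: (real_normed_vector) real_vector
begin

lift_definition zero_c0 :: "'a c0" is "\<lambda>_. 0" by simp
lift_definition plus_c0 :: "'a c0 \<Rightarrow> 'a c0 \<Rightarrow> 'a c0" is "\<lambda>x y n. x n + y n"
  by (auto intro: tendsto_add_zero)
lift_definition uminus_c0 :: "'a c0 \<Rightarrow> 'a c0" is "\<lambda>x n. - x n"
  using tendsto_minus by fastforce
lift_definition minus_c0 :: "'a c0 \<Rightarrow> 'a c0 \<Rightarrow> 'a c0" is "\<lambda>x y n. x n - y n"
  using tendsto_diff by fastforce
lift_definition scaleR_c0 :: "real \<Rightarrow> 'a c0 \<Rightarrow> 'a c0" is "\<lambda>r x n. r *\<^sub>R x n"
  using tendsto_scaleR[OF tendsto_const] by fastforce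

instance
proof
  fix a b :: real and x y z :: "'a c0"
  show "x + y + z = x + (y + z)" by transfer (simp add: add.assoc)
  show "x + y = y + x" by transfer (simp add: add.commute)
  show "0 + x = x" by transfer simp
  show "- x + x = 0" by transfer simp
  show "x - y = x + - y" by transfer simp
  show "a *\<^sub>R (x + y) = a *\<^sub>R x + a *\<^sub>R y" by transfer (simp add: scaleR_add_right)
  show "(a + b) *\<^sub>R x = a *\<^sub>R x + b *\<^sub>R x" by transfer (simp add: scaleR_add_left)
  show "a *\<^sub>R b *\<^sub>R x = (a * b) *\<^sub>R x" by transfer simp
  show "1 *\<^sub>R x = x" by transfer simp
qed

end

instantiation c0 :: (real_normed_vector) real_normed_vector
begin

definition norm_c0 :: "'a c0 \<Rightarrow> real" where
  "norm_c0 x = (SUP n. norm (c0_nth x n))"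
definition sgn_c0 :: "'a c0 \<Rightarrow> 'a c0" where
  "sgn_c0 x = x /\<^sub>R norm x"
definition dist_c0 :: "'a c0 \<Rightarrow> 'a c0 \<Rightarrow> real" where
  "dist_c0 x y = norm (x - y)"
definition uniformity_c0 :: "('a c0 \<times> 'a c0) filter" where
  "uniformity_c0 = (INF e\<in>{0<..}. principal {(x, y). dist x y < e})"
definition open_c0 :: "'a c0 set \<Rightarrow> bool" where
  "open_c0 U = (\<forall>x\<in>U. \<forall>\<^sub>F (x', y) in uniformity. x' = x \<longrightarrow> y \<in> U)"

lemma norm_c0_nth_le: "norm (c0_nth x n) \<le> norm (x :: 'a c0)"
  unfolding norm_c0_def by (rule cSUP_upper[OF _ c0_bdd_above]) simp

instance
proof
  fix a :: real and x y :: "'a c0"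
  show "dist x y = norm (x - y)" by (rule dist_c0_def)
  show "sgn x = x /\<^sub>R norm x" by (rule sgn_c0_def)
  show "(uniformity :: ('a c0 \<times> 'a c0) filter)
      = (INF e\<in>{0<..}. principal {(x, y). dist x y < e})"
    by (rule uniformity_c0_def)
  show "open U = (\<forall>x\<in>U. \<forall>\<^sub>F (x', y) in uniformity. x' = x \<longrightarrow> y \<in> U)"
    for U :: "'a c0 set" by (rule open_c0_def)
  show "norm x = 0 \<longleftrightarrow> x = 0"
  proof
    assume "norm x = 0"
    then have "c0_nth x n = 0" for n using norm_c0_nth_le[of x n] by simp
    then show "x = 0" by (intro c0_eqI) (simp add: zero_c0.rep_eq)
  qed (simp add: norm_c0_def zero_c0.rep_eq)
  show "norm (x + y) \<le> norm x + norm y"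
    unfolding norm_c0_def[of "x + y"]
  proof (rule cSUP_least)
    fix n
    show "norm (c0_nth (x + y) n) \<le> norm x + norm y"
      using norm_triangle_ineq[of "c0_nth x n" "c0_nth y n"]
        norm_c0_nth_le[of x n] norm_c0_nth_le[of y n]
      by (simp add: plus_c0.rep_eq)
  qed simp
  have le: "norm (r *\<^sub>R u) \<le> \<bar>r\<bar> * norm u" for r and u :: "'a c0"
    unfolding norm_c0_def[of "r *\<^sub>R u"]
    by (rule cSUP_least) (auto simp: scaleR_c0.rep_eq intro: mult_left_mono norm_c0_nth_le)
  show "norm (a *\<^sub>R x) = \<bar>a\<bar> * norm x"
  proof (cases "a = 0")
    case True
    have "0 \<le> norm (a *\<^sub>R x)" using norm_c0_nth_le norm_ge_zero order_trans by blast
    then show ?thesis using le[of a x] True by simp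
  next
    case False
    have "inverse a *\<^sub>R a *\<^sub>R x = x" using False by transfer simp
    then have "norm x \<le> \<bar>inverse a\<bar> * norm (a *\<^sub>R x)" using le[of "inverse a" "a *\<^sub>R x"] by simp
    then have "\<bar>a\<bar> * norm x \<le> norm (a *\<^sub>R x)" using False by (simp add: field_simps abs_inverse)
    then show ?thesis using le[of a x] by simp
  qed
qed

end

lift_definition c0_scale :: "'a::real_normed_field \<Rightarrow> 'a c0 \<Rightarrow> 'a c0" is "\<lambda>c x n. c * x n"
  by (auto intro: tendsto_mult_right_zero)

lift_definition c0_basis :: "nat \<Rightarrow> 'a::real_normed_field c0"
  is "\<lambda>m n. if n = m then 1 else 0"
proof -
  fix m :: nat
  have "\<forall>\<^sub>F n in sequentially. (if n = m then 1 else 0) = (0::'a)"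
    using eventually_gt_at_top[of m] by eventually_elim auto
  then show "(\<lambda>n. if n = m then 1 else 0 :: 'a) \<longlonglongrightarrow> 0"
    by (simp add: tendsto_eventually)
qed

text \<open>Linearity is over the scalar field \<open>'a\<close>, not merely over the reals.  Since the span of the
  canonical basis is dense, the conditions determine the operator uniquely.  The weights are
  indexed from 1; the value \<open>w 0\<close> is irrelevant.\<close>

definition is_weighted_shift ::
    "(nat \<Rightarrow> 'a) \<Rightarrow> ('a::real_normed_field c0 \<Rightarrow> 'a c0) \<Rightarrow> bool" where
  "is_weighted_shift w T \<longleftrightarrow>
     bounded (w ` {1..}) \<and> (\<forall>n\<ge>1. w n \<noteq> 0) \<and>
     Vector_Spaces.linear c0_scale c0_scale T \<and> continuous_on UNIV T \<and>
     T (c0_basis 0) = 0 \<and> (\<forall>n\<ge>1. T (c0_basis n) = c0_scale (w n) (c0_basis (n - 1)))"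

definition upper_density :: "nat set \<Rightarrow> ereal" where
  "upper_density A = limsup (\<lambda>k. ereal (real (card (A \<inter> {0..k})) / real k))"

definition banach_alpha :: "nat set \<Rightarrow> nat \<Rightarrow> ereal" where
  "banach_alpha A s = limsup (\<lambda>k. ereal (real (card (A \<inter> {k+1..k+s}))))"

text \<open>The limit always exists, since \<open>banach_alpha A\<close> is subadditive and bounded by \<open>s\<close>.\<close>

definition upper_banach_density :: "nat set \<Rightarrow> ereal" where
  "upper_banach_density A = lim (\<lambda>s. banach_alpha A s / ereal (real s))"

definition return_set :: "('x \<Rightarrow> 'x) \<Rightarrow> 'x \<Rightarrow> 'x set \<Rightarrow> nat set" where
  "return_set T x V = {n. (T ^^ n) x \<in> V}"

definition U_frequently_hypercyclic :: "('x::topological_space \<Rightarrow> 'x) \<Rightarrow> bool" where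
  "U_frequently_hypercyclic T \<longleftrightarrow>
     (\<exists>x. \<forall>V. open V \<and> V \<noteq> {} \<longrightarrow> upper_density (return_set T x V) > 0)"

definition reiteratively_hypercyclic :: "('x::topological_space \<Rightarrow> 'x) \<Rightarrow> bool" where
  "reiteratively_hypercyclic T \<longleftrightarrow>
     (\<exists>x. \<forall>V. open V \<and> V \<noteq> {} \<longrightarrow> upper_banach_density (return_set T x V) > 0)"

end

theory Submission
  imports Defs
begin

text \<open>
  For a weighted shift with weight products \<open>W n = w 1 * \<dots> * w n\<close>, the coordinate \<open>c\<close> of \<open>T\<^sup>n x\<close>
  is \<open>W (n + c) / W c * x (n + c)\<close>.  Two facts about \<open>W\<close> follow.

  If \<open>n\<close> runs through the visits of an orbit to the unit ball around \<open>2 e\<^sub>0\<close>, then \<open>W n * x n\<close> stays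
  away from 0, hence \<open>W n\<close> tends to infinity along these visits.  So if the upper density of
  \<open>{n. W n \<ge> 16 ^ l}\<close> tends to 0 as \<open>l\<close> grows, the shift is not \<open>\<UU>\<close>-frequently
  hypercyclic (\<open>not_U_frequently_hypercyclic_backward_shift\<close>).

  Conversely, to build a vector whose orbit is often close to prescribed finitely supported targets
  \<open>z k\<close>, copies of the targets are placed along a set of starting points.  The copy at \<open>n'\<close>
  disturbs the approximation at \<open>n < n'\<close> by a quantity of size \<open>1 / W c\<close> with \<open>c\<close> close to
  \<open>n' - n\<close>.  Thus \<open>W\<close> has to be large at the starting points, for the vector to be null, and at their
  differences.  Positive upper Banach density needs only long finite progressions of
  a fixed spacing \<open>8 ^ k\<close>, placed in very sparse blocks.  Within a block the differences
  are multiples of \<open>8 ^ k\<close>, a set whose density is as small as desired; the differences between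
  blocks, as well as the blocks themselves, are contained in sparse windows of density 0.

  So both requirements are compatible: \<open>W = 16 ^ height\<close>, where \<open>height\<close> is at least \<open>k\<close> near the
  multiples of \<open>8 ^ k\<close> and in the windows \<open>[block_start k - margin k, block_start k + margin k]\<close>,
  with ramps of slope 1 that keep the weights bounded.  The lemma \<open>card_near_le\<close> bounds the density of
  the set where the height is large, and \<open>pattern_approximates_target\<close> estimates the disturbances.
  The limit in the definition of the upper Banach density exists by subadditivity
  (\<open>subadditive_quotient_convergent\<close>).
\<close>

section \<open>Upper Banach density\<close>

lemma subadditive_mult_le:
  fixes u :: "nat \<Rightarrow> real"
  assumes "\<And>m n. u (m + n) \<le> u m + u n"
  shows "u (r + q * p) \<le> u r + real q * u p"
proof (induction q)
  case (Suc q)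
  have "u (r + Suc q * p) \<le> u (r + q * p) + u p"
    using assms[of "r + q * p" p] by (simp add: algebra_simps)
  with Suc show ?case by (simp add: algebra_simps)
qed simp

text \<open>Fekete's lemma: writing \<open>n = r + q p\<close> with \<open>r < p\<close> bounds \<open>u n / n\<close> by \<open>u p / p\<close> up to an
  error that vanishes as \<open>n\<close> grows, for every \<open>p\<close>; so the limit is the infimum of the quotients.\<close>

lemma subadditive_quotient_convergent:
  fixes u :: "nat \<Rightarrow> real"
  assumes sub: "\<And>m n. u (m + n) \<le> u m + u n" and nonneg: "\<And>n. 0 \<le> u n"
  shows "convergent (\<lambda>n. u n / real n)"
proof -
  define L where "L = (INF n\<in>{1..}. u n / real n)"
  have bdd: "bdd_below ((\<lambda>n. u n / real n) ` {1..})"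
    by (rule bdd_belowI2[of _ 0]) (simp add: nonneg)
  have lower: "L \<le> u n / real n" if "n \<ge> 1" for n
    unfolding L_def using that by (intro cINF_lower[OF bdd]) auto
  have "(\<lambda>n. u n / real n) \<longlonglongrightarrow> L"
  proof (rule LIMSEQ_I)
    fix e :: real assume e: "0 < e"
    obtain p where p: "p \<ge> 1" "u p / real p < L + e / 2"
    proof -
      have "\<exists>p\<in>{1..}. u p / real p < L + e / 2"
      proof (rule ccontr)
        assume "\<not> ?thesis"
        then have "L + e / 2 \<le> L"
          unfolding L_def by (intro cINF_greatest) (auto simp: L_def not_less)
        with e show False by simp
      qed
      then show ?thesis using that by auto
    qed
    define M where "M = (\<Sum>r<p. u r)"
    have M: "u r \<le> M" if "r < p" for r
      unfolding M_def using that nonneg by (intro member_le_sum) auto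
    obtain n0 :: nat where n0: "2 * M / e < real n0" using reals_Archimedean2 by blast
    have "norm (u n / real n - L) < e" if n: "n \<ge> max 1 n0" for n
    proof -
      have npos: "real n > 0" using n by simp
      have "u n = u (n mod p + (n div p) * p)" by simp
      also have "\<dots> \<le> u (n mod p) + real (n div p) * u p"
        by (rule subadditive_mult_le[OF sub])
      also have "\<dots> \<le> M + real n / real p * u p"
        using p M[of "n mod p"] nonneg[of p] of_nat_div_le_of_nat[of n p]
        by (intro add_mono mult_right_mono) auto
      finally have "u n / real n \<le> (M + real n / real p * u p) / real n"
        using npos by (simp add: divide_right_mono)
      also have "\<dots> = M / real n + u p / real p"
        using npos by (simp add: add_divide_distrib)
      finally have "u n / real n \<le> M / real n + u p / real p" .
      moreover have "M / real n < e / 2"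
      proof -
        have "2 * M < e * real n0" using n0 e by (simp add: field_simps)
        also have "\<dots> \<le> e * real n" using n e by simp
        finally show ?thesis using npos by (simp add: field_simps)
      qed
      ultimately have "u n / real n < L + e" using p(2) by linarith
      with lower[of n] n e show ?thesis by auto
    qed
    then show "\<exists>n0. \<forall>n\<ge>n0. norm (u n / real n - L) < e" by blast
  qed
  then show ?thesis by (rule convergentI)
qed

lemma card_window_le: "card (A \<inter> {k+1..k+s}) \<le> (s::nat)"
proof -
  have "card (A \<inter> {k+1..k+s}) \<le> card {k+1..k+s}" by (intro card_mono) auto
  then show ?thesis by simp
qed

lemma banach_alpha_add: "banach_alpha A (s + t) \<le> banach_alpha A s + banach_alpha A t"
proof -
  let ?f = "\<lambda>s k. ereal (real (card (A \<inter> {k+1..k+s})))"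
  have split: "?f (s + t) k = ?f s k + ?f t (k + s)" for k
  proof -
    have eq: "A \<inter> {k+1..k+(s+t)} = (A \<inter> {k+1..k+s}) \<union> (A \<inter> {(k+s)+1..(k+s)+t})" by auto
    show ?thesis unfolding eq by (subst card_Un_disjoint) auto
  qed
  have "banach_alpha A (s + t) = limsup (\<lambda>k. ?f s k + ?f t (k + s))"
    unfolding banach_alpha_def split ..
  also have "\<dots> \<le> limsup (?f s) + limsup (\<lambda>k. ?f t (k + s))"
    by (rule ereal_limsup_add_mono)
  also have "limsup (\<lambda>k. ?f t (k + s)) = limsup (?f t)"
    by (rule limsup_shift_k[of "?f t"])
  finally show ?thesis unfolding banach_alpha_def .
qed

lemma banach_alpha_bounds: "0 \<le> banach_alpha A s" "banach_alpha A s \<le> ereal (real s)"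
proof -
  show "banach_alpha A s \<le> ereal (real s)"
    unfolding banach_alpha_def using card_window_le[of A _ s]
    by (intro Limsup_bounded always_eventually) auto
  show "0 \<le> banach_alpha A s"
    unfolding banach_alpha_def by (intro le_Limsup always_eventually) auto
qed

lemma upper_banach_density_ge:
  assumes "\<forall>\<^sub>F s in sequentially. ereal (c * real s) \<le> banach_alpha A s"
  shows "ereal c \<le> upper_banach_density A"
proof -
  define a where "a s = real_of_ereal (banach_alpha A s)" for s
  have a: "banach_alpha A s = ereal (a s)" for s
    using banach_alpha_bounds[of A s] unfolding a_def
    by (cases "banach_alpha A s") auto
  have "convergent (\<lambda>s. a s / real s)"
    using banach_alpha_add[of A] banach_alpha_bounds[of A]
    by (intro subadditive_quotient_convergent) (simp_all add: a)
  then obtain l where l: "(\<lambda>s. a s / real s) \<longlonglongrightarrow> l" by (auto simp: convergent_def)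
  have "(\<lambda>s. ereal (a s / real s)) \<longlonglongrightarrow> ereal l" using l by simp
  moreover have "\<forall>\<^sub>F s in sequentially. ereal (a s / real s) = banach_alpha A s / ereal (real s)"
    using eventually_gt_at_top[of 0] by eventually_elim (simp add: a)
  ultimately have "(\<lambda>s. banach_alpha A s / ereal (real s)) \<longlonglongrightarrow> ereal l"
    by (rule Lim_transform_eventually)
  then have "upper_banach_density A = ereal l"
    unfolding upper_banach_density_def by (rule limI)
  moreover have "c \<le> l"
  proof (rule tendsto_lowerbound[OF l _ sequentially_bot])
    show "\<forall>\<^sub>F s in sequentially. c \<le> a s / real s"
      using assms eventually_gt_at_top[of 0]
      by eventually_elim (simp add: a field_simps)
  qed
  ultimately show ?thesis by simp
qed

text \<open>The return sets of the construction contain arbitrarily long arithmetic progressions of a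
  fixed difference \<open>d\<close>, arbitrarily far out; this alone forces positive upper Banach density.\<close>

lemma upper_banach_density_pos_if_progressions:
  fixes A :: "nat set"
  assumes d: "d > 0"
    and prog: "\<And>s k. \<exists>N\<ge>k. \<forall>i\<le>s. N + i * d \<in> A"
  shows "upper_banach_density A > 0"
proof -
  have alpha: "ereal (real (s div d)) \<le> banach_alpha A s" for s
    unfolding banach_alpha_def
  proof (rule Limsup_greatest)
    fix P :: "nat \<Rightarrow> bool" assume "eventually P sequentially"
    then obtain k where k: "\<And>n. n \<ge> k \<Longrightarrow> P n" by (auto simp: eventually_sequentially)
    obtain N where N: "N \<ge> k" "\<And>i. i \<le> s \<Longrightarrow> N + i * d \<in> A" using prog by blast
    have sub: "(\<lambda>i. N + i * d) ` {1..s div d} \<subseteq> A \<inter> {N+1..N+s}"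
    proof
      fix x assume "x \<in> (\<lambda>i. N + i * d) ` {1..s div d}"
      then obtain i where i: "x = N + i * d" "i \<in> {1..s div d}" by (rule imageE)
      have "i * d \<le> s div d * d" using i(2) by (intro mult_right_mono) auto
      then have "i * d \<le> s" using div_times_less_eq_dividend[of s d] by linarith
      moreover have "i * 1 \<le> i * d" using d by (intro mult_left_mono) auto
      moreover have "1 \<le> i" using i(2) by simp
      ultimately have "1 \<le> i * d" "i * d \<le> s" "i \<le> s" by linarith+
      then show "x \<in> A \<inter> {N+1..N+s}" using N(2)[of i] unfolding i(1) by simp
    qed
    have "inj_on (\<lambda>i. N + i * d) {1..s div d}" using d by (auto simp: inj_on_def)
    then have "s div d = card ((\<lambda>i. N + i * d) ` {1..s div d})" by (simp add: card_image)
    also have "\<dots> \<le> card (A \<inter> {N+1..N+s})" using sub by (intro card_mono) auto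
    finally have "ereal (real (s div d)) \<le> ereal (real (card (A \<inter> {N+1..N+s})))" by simp
    also have "\<dots> \<le> (SUP k\<in>Collect P. ereal (real (card (A \<inter> {k+1..k+s}))))"
      using k[OF N(1)] by (intro SUP_upper) auto
    finally show "ereal (real (s div d)) \<le> (SUP k\<in>Collect P. ereal (real (card (A \<inter> {k+1..k+s}))))" .
  qed
  have "ereal (1 / (2 * real d)) \<le> upper_banach_density A"
  proof (rule upper_banach_density_ge)
    show "\<forall>\<^sub>F s in sequentially. ereal (1 / (2 * real d) * real s) \<le> banach_alpha A s"
      using eventually_ge_at_top[of d]
    proof eventually_elim
      case (elim s)
      have "s div d \<ge> 1" using elim d by (simp add: Suc_le_eq div_greater_zero_iff)
      then have "d * 1 \<le> d * (s div d)" by (intro mult_left_mono) auto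
      moreover have "s = d * (s div d) + s mod d" by simp
      moreover have "s mod d < d" using d by simp
      ultimately have "s \<le> 2 * (d * (s div d))" by linarith
      then have "s \<le> 2 * d * (s div d)" by (simp only: mult.assoc)
      then have "real s \<le> real (2 * d * (s div d))" by (simp only: of_nat_le_iff)
      then have "real s \<le> 2 * real d * real (s div d)" by simp
      then have "1 / (2 * real d) * real s \<le> real (s div d)"
        using d by (simp add: field_simps)
      then show ?case using alpha[of s] by (meson ereal_less_eq(3) order_trans)
    qed
  qed
  moreover have "0 < ereal (1 / (2 * real d))" using d by simp
  ultimately show ?thesis by (rule less_le_trans[rotated])
qed

section \<open>Where the weight products are large\<close>

text \<open>A block consists of starting points \<open>block_start t + i * 8 ^ k\<close> with \<open>i \<le> t\<close>, where \<open>k \<le> t\<close>, and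
  of the \<open>k\<close> numbers after each.  The window of radius \<open>margin t\<close> around \<open>block_start t\<close> contains it,
  thanks to the summands \<open>t * 8 ^ t + t\<close>.  The radius also exceeds every starting point \<open>n\<close> of an
  earlier block, so that the window contains \<open>block_start t - n\<close> as well.  The factor \<open>8 ^ t\<close> in the
  recursion makes the window short compared with the numbers before it.\<close>

fun block_start :: "nat \<Rightarrow> nat" where
  "block_start 0 = 0"
| "block_start (Suc t) = 8 ^ Suc t * (block_start t + Suc t * 8 ^ Suc t + Suc t)"

definition margin :: "nat \<Rightarrow> nat" where
  "margin t = block_start (t - 1) + t * 8 ^ t + t"

lemma block_start_eq: "block_start t = 8 ^ t * margin t"
  by (cases t) (simp_all add: margin_def)

lemma margin_ge: "t * 8 ^ t + t \<le> margin t" "t \<le> margin t"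
  by (simp_all add: margin_def)

lemma le_block_start: "t \<le> block_start t"
proof -
  have "1 * t \<le> 8 ^ t * margin t" using margin_ge(2)[of t] by (intro mult_mono) auto
  then show ?thesis by (simp add: block_start_eq)
qed

lemma block_start_mono:
  assumes "s \<le> t" shows "block_start s \<le> block_start t"
proof (rule lift_Suc_mono_le[OF _ assms])
  fix t
  have "block_start t \<le> 1 * (block_start t + Suc t * 8 ^ Suc t + Suc t)" by simp
  also have "\<dots> \<le> block_start (Suc t)"
    unfolding block_start.simps(2) by (intro mult_right_mono) simp_all
  finally show "block_start t \<le> block_start (Suc t)" .
qed

lemma earlier_block_le_margin:
  assumes "s < t" shows "block_start s + s * 8 ^ s \<le> margin t"
proof -
  have "block_start s \<le> block_start (t - 1)" using assms by (intro block_start_mono) simp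
  moreover have "s * 8 ^ s \<le> t * (8 ^ t :: nat)" using assms by (intro mult_mono power_increasing) auto
  ultimately show ?thesis by (simp add: margin_def)
qed

lemma four_mult_le_power: "4 * k \<le> (8::nat) ^ k"
proof (induction k)
  case (Suc k)
  define x where "x = (8::nat) ^ k"
  have "1 \<le> x" "4 * k \<le> x" using Suc by (simp_all add: x_def)
  then have "4 * Suc k \<le> 8 * x" by presburger
  then show ?case by (simp add: x_def)
qed simp

lemma margin_small:
  assumes "k \<ge> 1" shows "8 * margin k \<le> block_start k"
proof -
  have "(8::nat) ^ 1 \<le> 8 ^ k" using assms by (intro power_increasing) auto
  then show ?thesis unfolding block_start_eq by (intro mult_right_mono) auto
qed

text \<open>The positions at which the weight product has to be at least \<open>16 ^ k\<close>.  The first set contains the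
  distances from a starting point to all later copies in the same block, if that block has spacing
  \<open>8 ^ k\<close>.  The second contains the \<open>k\<close>-th block, as well as the distances from the starting points of
  earlier blocks to the positions in the \<open>k\<close>-th one.\<close>

definition sites :: "nat \<Rightarrow> nat set" where
  "sites k = {i * 8 ^ k + j |i j. 1 \<le> i \<and> j \<le> k} \<union>
             {block_start k - margin k..block_start k + margin k}"

lemma sites_ge:
  assumes "m \<in> sites k" shows "4 * k \<le> m"
proof (cases "k = 0")
  case False
  consider i j where "m = i * 8 ^ k + j" "1 \<le> i" | "block_start k - margin k \<le> m"
    using assms by (auto simp: sites_def)
  then show ?thesis
  proof cases
    case 1
    then have "1 * 8 ^ k \<le> i * (8::nat) ^ k" by (intro mult_right_mono) auto
    then show ?thesis using 1 four_mult_le_power[of k] by linarith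
  next
    case 2
    then show ?thesis
      using margin_small[of k] margin_ge(2)[of k] False by linarith
  qed
qed simp

text \<open>The product of the first \<open>n\<close> weights can grow only by a bounded factor per step, so the height \<open>k\<close>
  at a site has to be prepared by a ramp of slope 1 to its left: \<open>near l\<close> collects the points at
  which some ramp has already reached level \<open>l\<close>.  To the right of a site the height may drop at
  once, since weights may be arbitrarily small.\<close>

definition near :: "nat \<Rightarrow> nat set" where
  "near l = {n. \<exists>k m. m \<in> sites k \<and> n \<le> m \<and> m + l \<le> n + k}"

definition height :: "nat \<Rightarrow> nat" where
  "height n = Sup {l. n \<in> near l}"

lemma near_zero: "n \<in> near 0"
proof -
  \<comment> \<open>Level 0 imposes no condition: its spacing is 1, so every number is a site.\<close>
  have "n \<in> sites 0" by (cases n) (auto simp: sites_def margin_def)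
  then show ?thesis unfolding near_def by (intro CollectI exI[of _ 0] exI[of _ n]) auto
qed

lemma near_antimono: "l \<le> l' \<Longrightarrow> near l' \<subseteq> near l"
  by (force simp: near_def)

lemma near_Suc: "Suc n \<in> near (Suc l) \<Longrightarrow> n \<in> near l"
  unfolding near_def by force

text \<open>Sites of level \<open>k\<close> do not occur before \<open>4 k\<close>, so ramps start late.  Consequently the height is
  finite, and the weight products at \<open>0, \<dots>, k\<close> are at most \<open>2 ^ k\<close>, which is far below the value
  \<open>16 ^ k\<close> demanded at the sites of level \<open>k\<close>.\<close>

lemma near_bound:
  assumes "n \<in> near l" shows "4 * l \<le> n"
proof -
  obtain k m where "m \<in> sites k" "n \<le> m" "m + l \<le> n + k" using assms by (auto simp: near_def)
  then show ?thesis using sites_ge[of m k] by linarith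
qed

lemma le_height_iff: "l \<le> height n \<longleftrightarrow> n \<in> near l"
proof -
  let ?L = "{l. n \<in> near l}"
  have ne: "?L \<noteq> {}" using near_zero by auto
  have fin: "finite ?L" by (rule finite_subset[of _ "{..n}"]) (auto dest: near_bound)
  have h: "height n = Max ?L" using ne unfolding height_def Sup_nat_def by auto
  show ?thesis
  proof
    assume "l \<le> height n"
    moreover have "n \<in> near (height n)" using Max_in[OF fin ne] unfolding h by simp
    ultimately show "n \<in> near l" using near_antimono by blast
  next
    assume "n \<in> near l"
    then show "l \<le> height n" using fin unfolding h by (intro Max_ge) auto
  qed
qed

lemma height_Suc_le: "height (Suc n) \<le> Suc (height n)"
proof (cases "height (Suc n)")
  case (Suc l)
  then have "Suc n \<in> near (Suc l)" using le_height_iff[of "Suc l" "Suc n"] by simp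
  then show ?thesis using Suc le_height_iff near_Suc by simp
qed simp

lemma height_le: "4 * height n \<le> n"
  using near_bound le_height_iff by blast

lemma sites_height:
  assumes "m \<in> sites k" shows "k \<le> height m"
  unfolding le_height_iff near_def using assms by auto

definition ramp :: "nat \<Rightarrow> nat set" where
  "ramp k = {n. \<exists>m. m \<in> sites k \<and> n \<le> m \<and> m \<le> n + k}"

lemma two_mult_plus_one_le_power: "2 * k + 1 \<le> (4::nat) ^ k"
  by (induction k) auto

text \<open>The ramps up to \<open>M\<close> cost at most \<open>2 * M / 8 ^ k\<close> intervals of length \<open>2 k + 1\<close> near the multiples
  of \<open>8 ^ k\<close>, and one long interval around \<open>block_start k\<close>, which meets \<open>{0..M}\<close> only if \<open>M\<close> is
  large compared with its length.\<close>

lemma ramp_subset: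
  assumes "k \<ge> 1"
  shows "ramp k \<inter> {0..M} \<subseteq>
    (\<Union>i\<in>{1..2 * M div 8 ^ k}. {i * 8 ^ k - k..i * 8 ^ k + k}) \<union>
    (if 2 * margin k + M < block_start k then {} else {block_start k - 2 * margin k..block_start k + margin k})"
proof
  fix n assume n: "n \<in> ramp k \<inter> {0..M}"
  then obtain m where m: "m \<in> sites k" "n \<le> m" "m \<le> n + k" by (auto simp: ramp_def)
  consider i j where "m = i * 8 ^ k + j" "1 \<le> i" "j \<le> k"
    | "block_start k - margin k \<le> m" "m \<le> block_start k + margin k"
    using m(1) by (auto simp: sites_def)
  then show "n \<in> (\<Union>i\<in>{1..2 * M div 8 ^ k}. {i * 8 ^ k - k..i * 8 ^ k + k}) \<union>
    (if 2 * margin k + M < block_start k then {} else {block_start k - 2 * margin k..block_start k + margin k})"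
  proof cases
    case 1
    define x where "x = i * (8::nat) ^ k"
    have "1 * 8 ^ k \<le> x" unfolding x_def using 1 by (intro mult_right_mono) auto
    then have "4 * k \<le> x" using four_mult_le_power[of k] by linarith
    moreover have "m = x + j" using 1 by (simp add: x_def)
    ultimately have "x \<le> 2 * M" using 1 m n by (simp; linarith)
    then have "i * 8 ^ k \<le> 2 * M" by (simp add: x_def)
    then have "i \<le> 2 * M div 8 ^ k" by (simp add: less_eq_div_iff_mult_less_eq)
    moreover have "n \<in> {i * 8 ^ k - k..i * 8 ^ k + k}" using 1 m by auto
    ultimately show ?thesis using 1 by (intro UnI1 UN_I[of i]) auto
  next
    case 2
    then have "block_start k \<le> n + 2 * margin k" "n \<le> block_start k + margin k"
      using m margin_ge(2)[of k] by linarith+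
    then show ?thesis using n by (intro UnI2) auto
  qed
qed

lemma card_ramp_le:
  assumes "k \<ge> 1"
  shows "real (card (ramp k \<inter> {0..M})) \<le> 10 * real M / 2 ^ k"
proof -
  define U where "U = (\<Union>i\<in>{1..2 * M div 8 ^ k}. {i * 8 ^ k - k..i * 8 ^ k + k})"
  define V where "V = (if 2 * margin k + M < block_start k then {}
    else {block_start k - 2 * margin k..block_start k + margin k})"
  have fin: "finite U" "finite V" by (auto simp: U_def V_def)
  have "card U \<le> (\<Sum>i\<in>{1..2 * M div 8 ^ k}. card {i * 8 ^ k - k..i * 8 ^ k + k})"
    unfolding U_def by (rule card_UN_le) simp
  also have "\<dots> \<le> (\<Sum>i\<in>{1..2 * M div 8 ^ k}. 2 * k + 1)" by (intro sum_mono) auto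
  also have "\<dots> = (2 * M div 8 ^ k) * (2 * k + 1)" by simp
  also have "\<dots> \<le> (2 * M div 8 ^ k) * 4 ^ k"
    by (intro mult_left_mono two_mult_plus_one_le_power) simp
  finally have "real (card U) \<le> real ((2 * M div 8 ^ k) * 4 ^ k)" by (simp only: of_nat_le_iff)
  also have "\<dots> = real (2 * M div 8 ^ k) * 4 ^ k" by simp
  also have "\<dots> \<le> (real (2 * M) / real (8 ^ k)) * 4 ^ k"
    by (intro mult_right_mono of_nat_div_le_of_nat) simp
  also have "\<dots> = 2 * real M / 2 ^ k"
    by (simp add: field_simps flip: power_mult_distrib)
  finally have U: "real (card U) \<le> 2 * real M / 2 ^ k" .
  have V: "real (card V) \<le> 8 * real M / 2 ^ k"
  proof (cases "2 * margin k + M < block_start k")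
    case False
    have "block_start k \<le> 2 * M"
      using False margin_small[OF assms] by linarith
    have "card V \<le> 4 * margin k"
      using False margin_ge(2)[of k] assms by (simp add: V_def)
    moreover have "8 ^ k * margin k \<le> 2 * M"
      using \<open>block_start k \<le> 2 * M\<close> by (simp add: block_start_eq)
    ultimately have "card V * 8 ^ k \<le> 4 * (8 ^ k * margin k)"
      using mult_right_mono[of "card V" "4 * margin k" "8 ^ k"]
      by (simp add: mult.assoc mult.commute[of "margin k"])
    also have "\<dots> \<le> 4 * (2 * M)" using \<open>8 ^ k * margin k \<le> 2 * M\<close> by (rule mult_left_mono) simp
    finally have "card V * 8 ^ k \<le> 4 * (2 * M)" .
    moreover have "card V * 2 ^ k \<le> card V * 8 ^ k" by (intro mult_left_mono power_mono) auto
    ultimately have "card V * 2 ^ k \<le> 4 * (2 * M)" by (rule order_trans[rotated])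
    then have "card V * 2 ^ k \<le> 8 * M" by simp
    then have "real (card V * 2 ^ k) \<le> real (8 * M)" by (simp only: of_nat_le_iff)
    then show ?thesis by (simp add: field_simps)
  qed (simp add: V_def)
  have "card (ramp k \<inter> {0..M}) \<le> card (U \<union> V)"
    using ramp_subset[OF assms] fin unfolding U_def V_def by (intro card_mono) auto
  also have "\<dots> \<le> card U + card V" by (rule card_Un_le)
  finally have "real (card (ramp k \<inter> {0..M})) \<le> real (card U) + real (card V)" by simp
  also have "\<dots> \<le> 10 * real M / 2 ^ k" using U V by (simp add: add_divide_distrib[symmetric])
  finally show ?thesis .
qed

text \<open>Every ramp that reaches level \<open>l\<close> belongs to some \<open>k \<ge> l\<close>, and only \<open>k \<le> M\<close> matter below \<open>M\<close>;
  the geometric series over these \<open>k\<close> gives a density bound that tends to 0 with growing \<open>l\<close>.\<close>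

lemma card_near_le:
  assumes "l \<ge> 1"
  shows "real (card (near l \<inter> {0..M})) \<le> 20 * real M / 2 ^ l"
proof -
  have sub: "near l \<inter> {0..M} \<subseteq> (\<Union>k\<in>{l..M}. ramp k \<inter> {0..M})"
  proof
    fix n assume n: "n \<in> near l \<inter> {0..M}"
    then obtain k m where km: "m \<in> sites k" "n \<le> m" "m + l \<le> n + k" by (auto simp: near_def)
    then have "k \<in> {l..M}" using sites_ge[of m k] n by auto
    moreover have "n \<in> ramp k" using km by (auto simp: ramp_def)
    ultimately show "n \<in> (\<Union>k\<in>{l..M}. ramp k \<inter> {0..M})" using n by blast
  qed
  have "card (near l \<inter> {0..M}) \<le> card (\<Union>k\<in>{l..M}. ramp k \<inter> {0..M})"
    using sub by (intro card_mono) auto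
  also have "\<dots> \<le> (\<Sum>k\<in>{l..M}. card (ramp k \<inter> {0..M}))" by (rule card_UN_le) simp
  finally have "real (card (near l \<inter> {0..M})) \<le> (\<Sum>k\<in>{l..M}. real (card (ramp k \<inter> {0..M})))"
    by (simp flip: of_nat_sum)
  also have "\<dots> \<le> (\<Sum>k\<in>{l..M}. 10 * real M * (1/2) ^ k)"
    using assms card_ramp_le by (intro sum_mono) (simp add: power_one_over)
  also have "\<dots> = 10 * real M * (\<Sum>k\<in>{l..M}. (1/2) ^ k)" by (simp add: sum_distrib_left)
  also have "(\<Sum>k\<in>{l..M}. (1/2::real) ^ k) \<le> 2 * (1/2) ^ l" by (simp add: sum_gp)
  finally show ?thesis by (simp add: power_one_over mult_left_mono)
qed

lemma upper_density_nonpos_if_eventually_near: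
  assumes "\<And>l. finite (A - near l)"
  shows "upper_density A \<le> 0"
proof (rule ccontr)
  assume "\<not> upper_density A \<le> 0"
  then obtain c where c: "0 < ereal c" "ereal c < upper_density A"
    using ereal_dense2[of 0 "upper_density A"] by (auto simp: not_le)
  obtain l0 where l0: "(1/2::real) ^ l0 < c / 21"
    using real_arch_pow_inv[of "c / 21" "1/2"] c by auto
  define l where "l = Suc l0"
  have l: "21 / 2 ^ l < c"
  proof -
    have "(1/2::real) ^ l \<le> (1/2) ^ l0" by (simp add: l_def)
    with l0 have "(1/2::real) ^ l < c / 21" by linarith
    then show ?thesis by (simp add: power_one_over field_simps)
  qed
  define C where "C = card (A - near l)"
  have "\<forall>\<^sub>F k in sequentially. ereal (real (card (A \<inter> {0..k})) / real k) \<le> ereal (21 / 2 ^ l)"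
    using eventually_gt_at_top[of "C * 2 ^ l"]
  proof eventually_elim
    case (elim k)
    have "card (A \<inter> {0..k}) \<le> card ((A - near l) \<union> (near l \<inter> {0..k}))"
      using assms by (intro card_mono) auto
    also have "\<dots> \<le> C + card (near l \<inter> {0..k})" unfolding C_def by (rule card_Un_le)
    finally have "real (card (A \<inter> {0..k})) \<le> real C + real (card (near l \<inter> {0..k}))" by simp
    also have "\<dots> \<le> real C + 20 * real k / 2 ^ l" using card_near_le[of l k] by (simp add: l_def)
    also have "real C \<le> real k / 2 ^ l"
    proof -
      have "real (C * 2 ^ l) \<le> real k" using elim by (simp only: of_nat_le_iff)
      then show ?thesis by (simp add: field_simps)
    qed
    finally have "real (card (A \<inter> {0..k})) \<le> 21 / 2 ^ l * real k" by (simp add: field_simps)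
    moreover have "real k > 0" using elim by simp
    ultimately show ?case by (simp add: pos_divide_le_eq)
  qed
  then have "upper_density A \<le> ereal (21 / 2 ^ l)"
    unfolding upper_density_def by (rule Limsup_bounded)
  with c l show False by (meson ereal_less(4) less_ereal.simps(1) less_le_trans not_less order.strict_trans)
qed

section \<open>Weighted shifts given by weight products\<close>

lemma c0_norm_le:
  assumes "\<And>n. norm (c0_nth x n) \<le> c" shows "norm x \<le> c"
  unfolding norm_c0_def using assms by (intro cSUP_least) auto

text \<open>The sequence on the right is null whenever the weights are bounded; for unbounded weights the
  value of \<open>Abs_c0\<close> may be arbitrary.\<close>

definition backward_shift :: "(nat \<Rightarrow> 'a::real_normed_field) \<Rightarrow> 'a c0 \<Rightarrow> 'a c0" where
  "backward_shift w x = Abs_c0 (\<lambda>n. w (Suc n) * c0_nth x (Suc n))"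

lemma c0_nth_backward_shift:
  assumes "bounded (w ` {1..})"
  shows "c0_nth (backward_shift w x) n = w (Suc n) * c0_nth x (Suc n)"
proof -
  obtain C where C: "\<And>m. m \<ge> 1 \<Longrightarrow> norm (w m) \<le> C"
    using assms unfolding bounded_iff by auto
  have "(\<lambda>n. c0_nth x (Suc n)) \<longlonglongrightarrow> 0" using c0_nth_tendsto by (rule LIMSEQ_Suc)
  then have "(\<lambda>n. C * norm (c0_nth x (Suc n))) \<longlonglongrightarrow> 0"
    by (intro tendsto_mult_right_zero tendsto_norm_zero)
  moreover have "\<forall>\<^sub>F n in sequentially. norm (w (Suc n) * c0_nth x (Suc n)) \<le> C * norm (c0_nth x (Suc n))"
    by (intro always_eventually allI) (simp add: norm_mult C mult_right_mono)
  ultimately have "(\<lambda>n. w (Suc n) * c0_nth x (Suc n)) \<longlonglongrightarrow> 0" by (rule Lim_null_comparison[rotated])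
  then show ?thesis by (simp add: backward_shift_def Abs_c0_inverse)
qed

lemma vector_space_c0_scale: "vector_space (c0_scale :: 'a::real_normed_field \<Rightarrow> _)"
  by unfold_locales (transfer; auto simp: algebra_simps)+

lemma is_weighted_shift_backward_shift:
  fixes w :: "nat \<Rightarrow> 'a::real_normed_field"
  assumes bdd: "bounded (w ` {1..})" and nz: "\<And>n. n \<ge> 1 \<Longrightarrow> w n \<noteq> 0"
  shows "is_weighted_shift w (backward_shift w)"
proof -
  note nth = c0_nth_backward_shift[OF bdd]
  obtain C where C: "\<And>m. m \<ge> 1 \<Longrightarrow> norm (w m) \<le> C"
    using bdd unfolding bounded_iff by auto
  have "bounded_linear (backward_shift w)"
  proof (rule bounded_linear_intro)
    show "norm (backward_shift w x) \<le> norm x * C" for x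
    proof (rule c0_norm_le)
      fix n
      have "norm (w (Suc n)) * norm (c0_nth x (Suc n)) \<le> C * norm x"
        using C[of "Suc n"] order_trans[OF norm_ge_zero C[of 1]]
        by (intro mult_mono norm_c0_nth_le) auto
      then show "norm (c0_nth (backward_shift w x) n) \<le> norm x * C"
        by (simp add: nth norm_mult mult.commute)
    qed
  qed (auto intro!: c0_eqI simp: nth plus_c0.rep_eq scaleR_c0.rep_eq algebra_simps)
  then have "continuous_on UNIV (backward_shift w)" by (rule linear_continuous_on)
  moreover have "Vector_Spaces.linear c0_scale c0_scale (backward_shift w)"
    by (intro Vector_Spaces.linear.intro module_hom.intro module_hom_axioms.intro
          vector_space_c0_scale[unfolded module_iff_vector_space[symmetric]] vector_space_c0_scale)
       (auto intro!: c0_eqI simp: nth plus_c0.rep_eq c0_scale.rep_eq algebra_simps)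
  moreover have "backward_shift w (c0_basis 0) = 0"
    by (rule c0_eqI) (simp add: nth c0_basis.rep_eq zero_c0.rep_eq)
  moreover have "backward_shift w (c0_basis n) = c0_scale (w n) (c0_basis (n - 1))" if "n \<ge> 1" for n
    using that by (intro c0_eqI) (auto simp: nth c0_basis.rep_eq c0_scale.rep_eq)
  ultimately show ?thesis using bdd nz by (auto simp: is_weighted_shift_def)
qed

text \<open>Since \<open>height 0 = 0\<close>, this is the product \<open>w 1 * \<dots> * w n\<close> of the weights defined next.\<close>

definition weight_prod :: "nat \<Rightarrow> real" where
  "weight_prod n = 16 ^ height n"

definition weight :: "nat \<Rightarrow> 'a::real_normed_field" where
  "weight n = of_real (weight_prod n / weight_prod (n - 1))"

lemma weight_prod_pos: "weight_prod n > 0"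
  by (simp add: weight_prod_def)

lemma weight_prod_le: "weight_prod n \<le> 2 ^ n"
proof -
  have "weight_prod n = 2 ^ (4 * height n)" by (simp add: weight_prod_def power_mult)
  also have "\<dots> \<le> 2 ^ n" using height_le by (intro power_increasing) auto
  finally show ?thesis .
qed

lemma weight_prod_sites: "m \<in> sites k \<Longrightarrow> 16 ^ k \<le> weight_prod m"
  unfolding weight_prod_def using sites_height by (intro power_increasing) auto

lemma weight_bounded: "bounded ((weight :: nat \<Rightarrow> 'a::real_normed_field) ` {1..})"
  unfolding bounded_iff
proof (intro exI ballI)
  fix v :: 'a assume "v \<in> weight ` {1..}"
  then obtain n where n: "n \<ge> 1" "v = weight n" by auto
  have "height n \<le> Suc (height (n - 1))" using height_Suc_le[of "n - 1"] n by simp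
  then have "weight_prod n \<le> 16 ^ Suc (height (n - 1))"
    unfolding weight_prod_def by (intro power_increasing) auto
  then have "weight_prod n / weight_prod (n - 1) \<le> 16"
    using weight_prod_pos[of "n - 1"] by (simp add: pos_divide_le_eq) (simp add: weight_prod_def)
  moreover have "weight_prod n / weight_prod (n - 1) > 0" by (simp add: weight_prod_pos)
  ultimately show "norm v \<le> 16" unfolding n(2) weight_def norm_of_real by linarith
qed

lemma weight_nonzero: "weight n \<noteq> 0"
  using weight_prod_pos[of n] weight_prod_pos[of "n - 1"] by (simp add: weight_def)

lemma c0_nth_backward_shift_iterate:
  fixes x :: "'a::real_normed_field c0"
  shows "c0_nth ((backward_shift weight ^^ n) x) c =
         of_real (weight_prod (n + c) / weight_prod c) * c0_nth x (n + c)"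
proof (induction n arbitrary: c)
  case 0
  then show ?case using weight_prod_pos[of c] by simp
next
  case (Suc n)
  have "c0_nth ((backward_shift weight ^^ Suc n) x) c =
      weight (Suc c) * (of_real (weight_prod (n + Suc c) / weight_prod (Suc c)) * c0_nth x (n + Suc c))"
    by (simp only: funpow.simps o_apply c0_nth_backward_shift[OF weight_bounded] Suc)
  then show ?case
    using weight_prod_pos[of c] weight_prod_pos[of "Suc c"] by (simp add: weight_def[of "Suc c"])
qed

section \<open>Return sets of upper density zero\<close>

text \<open>If \<open>T\<^sup>n x\<close> is close to \<open>2 e\<^sub>0\<close>, then the product of the first \<open>n\<close> weights times \<open>x\<^sub>n\<close> is bounded
  away from 0.  As \<open>x\<close> is a null sequence, the weight products tend to infinity along the
  return set, which therefore has upper density 0.\<close>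

lemma not_U_frequently_hypercyclic_backward_shift:
  "\<not> U_frequently_hypercyclic (backward_shift weight :: 'a::real_normed_field c0 \<Rightarrow> 'a c0)"
proof
  let ?T = "backward_shift weight :: 'a c0 \<Rightarrow> 'a c0"
  assume "U_frequently_hypercyclic ?T"
  then obtain x where x: "\<And>V. open V \<Longrightarrow> V \<noteq> {} \<Longrightarrow> upper_density (return_set ?T x V) > 0"
    unfolding U_frequently_hypercyclic_def by blast
  define V where "V = ball (c0_scale 2 (c0_basis 0) :: 'a c0) 1"
  define A where "A = return_set ?T x V"
  have large: "1 < weight_prod n * norm (c0_nth x n)" if n: "n \<in> A" for n
  proof -
    have "norm ((?T ^^ n) x - c0_scale 2 (c0_basis 0)) < 1"
      using n by (simp add: A_def return_set_def V_def dist_norm norm_minus_commute)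
    then have "norm (c0_nth ((?T ^^ n) x) 0 - 2) < 1"
      using norm_c0_nth_le[of "(?T ^^ n) x - c0_scale 2 (c0_basis 0)" 0]
      by (simp add: minus_c0.rep_eq c0_scale.rep_eq c0_basis.rep_eq)
    then have "1 < norm (c0_nth ((?T ^^ n) x) 0)"
      using norm_triangle_ineq2[of "2::'a" "2 - c0_nth ((?T ^^ n) x) 0"]
      by (simp add: norm_minus_commute)
    also have "height 0 = 0" using height_le[of 0] by simp
    then have "norm (c0_nth ((?T ^^ n) x) 0) = weight_prod n * norm (c0_nth x n)"
      using weight_prod_pos[of n]
      by (simp add: c0_nth_backward_shift_iterate norm_mult weight_prod_def[of 0])
    finally show ?thesis .
  qed
  have "finite (A - near l)" for l
  proof -
    have "\<forall>\<^sub>F n in sequentially. norm (c0_nth x n) < 1 / 16 ^ l"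
      using tendstoD[OF c0_nth_tendsto[of x], of "1 / 16 ^ l"] by simp
    then obtain n0 where n0: "\<And>n. n \<ge> n0 \<Longrightarrow> norm (c0_nth x n) < 1 / 16 ^ l"
      by (auto simp: eventually_sequentially)
    have "n \<in> near l" if n: "n \<in> A" "n \<ge> n0" for n
    proof (rule ccontr)
      assume "n \<notin> near l"
      then have "weight_prod n \<le> 16 ^ l"
        unfolding weight_prod_def by (intro power_increasing) (auto simp: le_height_iff[symmetric])
      then have "weight_prod n * norm (c0_nth x n) \<le> 16 ^ l * (1 / 16 ^ l)"
        using n0[OF n(2)] by (intro mult_mono) auto
      with large[OF n(1)] show False by simp
    qed
    then have "A - near l \<subseteq> {..<n0}" by (force simp: not_le[symmetric])
    then show ?thesis by (rule finite_subset) simp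
  qed
  then have "upper_density A \<le> 0" by (rule upper_density_nonpos_if_eventually_near)
  moreover have "upper_density A > 0" unfolding A_def V_def by (rule x) auto
  ultimately show False by simp
qed

section \<open>A reiteratively hypercyclic vector\<close>

text \<open>A dense sequence of finitely supported vectors in which every vector is approximated by terms
  of arbitrarily large index.  These repetitions allow the support and the norm of the \<open>k\<close>-th
  term to be bounded in terms of \<open>k\<close>: a term violating the bounds is truncated, and each list of
  coefficients satisfies them from some index on.\<close>

lemma exists_dense_targets:
  obtains z :: "nat \<Rightarrow> nat \<Rightarrow> 'a::{real_normed_field, second_countable_topology}"
  where "\<And>k j. k < j \<Longrightarrow> z k j = 0" "\<And>k j. norm (z k j) \<le> 2 ^ k"
    "\<And>(v :: 'a c0) e K. e > 0 \<Longrightarrow> \<exists>k\<ge>K. \<forall>j. norm (z k j - c0_nth v j) < e"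
proof -
  obtain D :: "'a set" where D: "countable D" "\<And>X. open X \<Longrightarrow> X \<noteq> {} \<Longrightarrow> \<exists>d\<in>D. d \<in> X"
    using countable_dense_exists by blast
  have "D \<noteq> {}" using D(2)[of UNIV] by auto
  then obtain e :: "nat \<Rightarrow> 'a" where e: "range e = D" using D(1) uncountable_def by metis
  have approx: "\<exists>i. norm (e i - a) < r" if "r > 0" for a r
    using D(2)[of "ball a r"] that unfolding e[symmetric]
    by (auto simp: dist_norm norm_minus_commute)
  define z where "z k j = (let l = from_nat (fst (prod_decode k)) :: nat list in
    if j < length l \<and> j \<le> k \<and> norm (e (l ! j)) \<le> 2 ^ k then e (l ! j) else 0)" for k j
  show thesis
  proof (rule that)
    show "z k j = 0" if "k < j" for k j using that by (simp add: z_def)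
    show "norm (z k j) \<le> 2 ^ k" for k j by (simp add: z_def Let_def)
    fix v :: "'a c0" and r :: real and K assume r: "r > 0"
    obtain J where J: "\<And>j. j \<ge> J \<Longrightarrow> norm (c0_nth v j) < r"
      using tendstoD[OF c0_nth_tendsto r] by (auto simp: eventually_sequentially)
    have "\<forall>j. \<exists>i. norm (e i - c0_nth v j) < r" using approx[OF r] by blast
    then obtain f where f: "\<And>j. norm (e (f j) - c0_nth v j) < r" by metis
    \<comment> \<open>The summands \<open>J\<close> and \<open>p\<close> make the index large enough for the support and norm bounds.\<close>
    define l where "l = map f [0..<J]"
    define M where "M = (\<Sum>j<J. norm (e (f j)))"
    obtain p where p: "M < 2 ^ p" using real_arch_pow[of 2 M] by auto
    define k where "k = prod_encode (to_nat l, K + J + p)"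
    have k: "K + J + p \<le> k" unfolding k_def by (rule le_prod_encode_2)
    have l: "from_nat (fst (prod_decode k)) = l" by (simp add: k_def)
    have "norm (z k j - c0_nth v j) < r" for j
    proof (cases "j < J")
      case True
      have "norm (e (f j)) \<le> M" unfolding M_def using True by (intro member_le_sum) auto
      also have "M \<le> 2 ^ p" using p by simp
      also have "\<dots> \<le> 2 ^ k" using k by (intro power_increasing) auto
      finally have "z k j = e (f j)" using True k unfolding z_def l by (simp add: l_def)
      then show ?thesis using f by simp
    next
      case False
      then have "z k j = 0" unfolding z_def l by (simp add: l_def)
      then show ?thesis using J[of j] False by simp
    qed
    then show "\<exists>k\<ge>K. \<forall>j. norm (z k j - c0_nth v j) < r" using k by (intro exI[of _ k]) auto
  qed
qed

definition block :: "nat \<Rightarrow> nat" where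
  "block m = Max {t. block_start t \<le> m}"

lemma le_block_iff: "t \<le> block m \<longleftrightarrow> block_start t \<le> m"
proof -
  have "{t. block_start t \<le> m} \<subseteq> {..m}" using order_trans[OF le_block_start] by blast
  then have fin: "finite {t. block_start t \<le> m}" by (rule finite_subset) simp
  have "0 \<in> {t. block_start t \<le> m}" by simp
  then have "{t. block_start t \<le> m} \<noteq> {}" by blast
  then have block: "block_start (block m) \<le> m" using Max_in[OF fin] by (simp add: block_def)
  show ?thesis
  proof
    assume "t \<le> block m"
    then show "block_start t \<le> m" using block block_start_mono order_trans by blast
  next
    assume "block_start t \<le> m"
    then show "t \<le> block m" using Max_ge[OF fin, of t] by (simp add: block_def)
  qed
qed

text \<open>Block \<open>t\<close> is devoted to target number \<open>label t\<close>.  Using a single target per block means that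
  within a block only multiples of one spacing occur as differences, and letting each label occur in
  infinitely many blocks, which become longer and longer, produces positive upper Banach density.\<close>

definition label :: "nat \<Rightarrow> nat" where
  "label t = fst (prod_decode t)"

lemma label_le: "label t \<le> t"
  using le_prod_encode_1[of "fst (prod_decode t)" "snd (prod_decode t)"] by (simp add: label_def)

lemma exists_late_block_with_label: "\<exists>t\<ge>n. label t = k"
  by (rule exI[of _ "prod_encode (k, n)"]) (simp add: label_def le_prod_encode_2)

text \<open>Copies of the target \<open>z k\<close>, multiplied by the weight products, placed at distance \<open>8 ^ k\<close> inside
  the blocks of label \<open>k\<close>.  Dividing by the weight products turns the pattern into a vector, and
  conjugates the weighted shift to the unweighted one.\<close>

definition pattern :: "(nat \<Rightarrow> nat \<Rightarrow> 'a::real_normed_field) \<Rightarrow> nat \<Rightarrow> 'a" where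
  "pattern z m =
    (let t = block m; k = label t; r = m - block_start t; j = r mod 8 ^ k
     in if r div 8 ^ k \<le> t then of_real (weight_prod j) * z k j else 0)"

locale targets =
  fixes z :: "nat \<Rightarrow> nat \<Rightarrow> 'a::real_normed_field"
  assumes support: "k < j \<Longrightarrow> z k j = 0"
    and norm_target_le: "norm (z k j) \<le> 2 ^ k"
begin

lemma norm_pattern_le: "norm (pattern z m) \<le> 4 ^ label (block m)"
proof -
  have *: "norm (of_real (weight_prod j) * z k j) \<le> 4 ^ k" for k j
  proof (cases "k < j")
    case False
    have "weight_prod j \<le> 2 ^ k"
      using weight_prod_le[of j] False power_increasing[of j k "2::real"] by linarith
    then have "weight_prod j * norm (z k j) \<le> 2 ^ k * 2 ^ k"
      using norm_target_le[of k j] by (intro mult_mono) auto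
    then show ?thesis using weight_prod_pos[of j] by (simp add: norm_mult flip: power_mult_distrib)
  qed (simp add: support)
  show ?thesis using * by (simp add: pattern_def Let_def)
qed

lemma pattern_nonzeroD:
  assumes "pattern z m \<noteq> 0"
  shows "block_start (block m) \<le> m" "m \<le> block_start (block m) + margin (block m)"
proof -
  define t where "t = block m"
  define k where "k = label t"
  define r where "r = m - block_start t"
  show start: "block_start (block m) \<le> m" using le_block_iff by blast
  have "r div 8 ^ k \<le> t" and "z k (r mod 8 ^ k) \<noteq> 0"
    using assms by (auto simp: pattern_def Let_def t_def k_def r_def split: if_splits)
  then have "r mod 8 ^ k \<le> k" using support[of k "r mod 8 ^ k"] by (meson not_less)
  then have "r mod 8 ^ k \<le> t" using label_le[of t] by (simp add: k_def)
  moreover have "r div 8 ^ k * 8 ^ k \<le> t * 8 ^ t"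
    using \<open>r div 8 ^ k \<le> t\<close> label_le[of t]
    by (intro mult_mono power_increasing) (simp_all add: k_def)
  ultimately have "r \<le> t * 8 ^ t + t" using div_mult_mod_eq[of r "8 ^ k"] by linarith
  then have "r \<le> margin t" using margin_ge(1)[of t] by linarith
  then show "m \<le> block_start (block m) + margin (block m)" using start by (simp add: r_def t_def)
qed

text \<open>The only estimate needed for tails: entries of the pattern in a block of label at most \<open>t\<close> are
  at most \<open>4 ^ t\<close>, whereas the weight product at a site of level \<open>t\<close> is at least \<open>16 ^ t\<close>.\<close>

lemma pattern_quotient_le:
  assumes "c \<in> sites t" "label (block m) \<le> t"
  shows "norm (pattern z m / of_real (weight_prod c)) \<le> (1/4) ^ t"
proof -
  have "(4::real) ^ label (block m) \<le> 4 ^ t" using assms(2) by (intro power_increasing) auto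
  with norm_pattern_le[of m] have "norm (pattern z m) \<le> 4 ^ t" by (rule order_trans)
  then have "norm (pattern z m) / weight_prod c \<le> 4 ^ t / 16 ^ t"
    using weight_prod_sites[OF assms(1)] by (intro frac_le) auto
  also have "\<dots> = (1/4) ^ t" by (simp flip: power_divide)
  finally show ?thesis using weight_prod_pos[of c] by (simp add: norm_divide)
qed

definition recurrent_vector :: "'a c0" where
  "recurrent_vector = Abs_c0 (\<lambda>m. pattern z m / of_real (weight_prod m))"

lemma c0_nth_recurrent_vector: "c0_nth recurrent_vector m = pattern z m / of_real (weight_prod m)"
proof -
  have le: "norm (pattern z m / of_real (weight_prod m)) \<le> (1/4) ^ block m" for m
  proof (cases "pattern z m = 0")
    case False
    then have "m \<in> sites (block m)" using pattern_nonzeroD[OF False] by (auto simp: sites_def)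
    then show ?thesis using label_le by (rule pattern_quotient_le)
  qed simp
  have "filterlim block at_top sequentially"
    unfolding filterlim_at_top by (auto simp: le_block_iff intro: eventually_ge_at_top)
  then have "(\<lambda>m. (1/4::real) ^ block m) \<longlonglongrightarrow> 0"
    by (rule filterlim_compose[rotated]) (rule LIMSEQ_power_zero, simp)
  then have "(\<lambda>m. pattern z m / of_real (weight_prod m)) \<longlonglongrightarrow> 0"
    by (rule Lim_null_comparison[rotated]) (use le in simp)
  then show ?thesis by (simp add: recurrent_vector_def Abs_c0_inverse)
qed

text \<open>Shifting a starting point \<open>n\<close> of block \<open>s\<close> to the origin moves its own copy of \<open>z k\<close> into place and
  leaves the entries of all later copies as an error.  A later copy in the same block contributes at
  coordinates in the first part of \<open>sites k\<close>.  A copy in a later block \<open>t\<close> contributes at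
  coordinates in the window around \<open>block_start t\<close>.  In both cases the weight product is large
  there, and the coordinate lies outside the support of \<open>z k\<close>.\<close>

lemma pattern_approximates_target:
  assumes i: "i \<le> s" and k: "k = label s" and n: "n = block_start s + i * 8 ^ k"
  shows "norm (pattern z (n + c) / of_real (weight_prod c) - z k c) \<le> (1/4) ^ k"
proof -
  define t where "t = block (n + c)"
  have "s \<le> t" unfolding t_def le_block_iff by (simp add: n)
  have "k \<le> s" by (simp add: k label_le)
  have kpow: "k < 8 ^ k" using four_mult_le_power[of k] by (cases "k = 0") auto
  show ?thesis
  proof (cases "s = t")
    \<comment> \<open>The coordinate \<open>n + c\<close> lies in the region of the same block.\<close>
    case True
    have r: "n + c - block_start (block (n + c)) = i * 8 ^ k + c"
      unfolding t_def[symmetric] True[symmetric] by (simp add: n)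
    have pat: "pattern z (n + c) =
        (if i + c div 8 ^ k \<le> s then of_real (weight_prod (c mod 8 ^ k)) * z k (c mod 8 ^ k) else 0)"
      unfolding pattern_def Let_def r unfolding t_def[symmetric] True[symmetric] k[symmetric]
      by (simp add: add.commute)
    show ?thesis
    proof (cases "c < 8 ^ k")
      case True
      then show ?thesis using i weight_prod_pos[of c] by (simp add: pat)
    next
      case False
      then have zc: "z k c = 0" using kpow by (intro support) simp
      show ?thesis
      proof (cases "c mod 8 ^ k \<le> k")
        case True
        have "c = (c div 8 ^ k) * 8 ^ k + c mod 8 ^ k" by (rule div_mult_mod_eq[symmetric])
        moreover have "1 \<le> c div 8 ^ k" using False by (simp add: Suc_le_eq div_greater_zero_iff)
        ultimately have "c \<in> sites k" using True unfolding sites_def by blast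
        then have "norm (pattern z (n + c) / of_real (weight_prod c)) \<le> (1/4) ^ k"
          using \<open>s = t\<close> by (intro pattern_quotient_le) (simp_all add: t_def[symmetric] k)
        then show ?thesis by (simp add: zc)
      next
        case False
        then show ?thesis using support[of k "c mod 8 ^ k"] by (simp add: pat zc)
      qed
    qed
  next
    \<comment> \<open>The coordinate \<open>n + c\<close> lies in the region of a later block.\<close>
    case False
    with \<open>s \<le> t\<close> have "s < t" by simp
    have "n \<le> block_start s + s * 8 ^ s"
      unfolding n using i \<open>k \<le> s\<close> by (intro add_left_mono mult_mono power_increasing) auto
    then have n_le: "n \<le> margin t" using earlier_block_le_margin[OF \<open>s < t\<close>] by linarith
    moreover have "block_start t \<le> n + c" using le_block_iff[of t "n + c"] by (simp add: t_def)
    ultimately have c_ge: "block_start t - margin t \<le> c" by linarith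
    have "8 * margin t \<le> block_start t" using \<open>s < t\<close> by (intro margin_small) simp
    then have "k < c" using c_ge margin_ge(2)[of t] \<open>s < t\<close> \<open>k \<le> s\<close> by linarith
    then have zc: "z k c = 0" by (rule support)
    show ?thesis
    proof (cases "pattern z (n + c) = 0")
      case False
      then have "c \<le> block_start t + margin t"
        using pattern_nonzeroD(2)[of "n + c"] by (simp add: t_def[symmetric])
      then have "c \<in> sites t" using c_ge by (simp add: sites_def)
      then have "norm (pattern z (n + c) / of_real (weight_prod c)) \<le> (1/4) ^ t"
        by (rule pattern_quotient_le) (simp add: t_def[symmetric] label_le)
      also have "\<dots> \<le> (1/4) ^ k" using \<open>k \<le> s\<close> \<open>s < t\<close> by (intro power_decreasing) auto
      finally show ?thesis by (simp add: zc)
    qed (simp add: zc)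
  qed
qed

lemma orbit_approximates_target:
  assumes "i \<le> s" "k = label s"
  shows "norm (c0_nth ((backward_shift weight ^^ (block_start s + i * 8 ^ k)) recurrent_vector) c - z k c)
    \<le> (1/4) ^ k"
  using pattern_approximates_target[OF assms refl, of c]
    weight_prod_pos[of "block_start s + i * 8 ^ k + c"]
  by (simp add: c0_nth_backward_shift_iterate c0_nth_recurrent_vector)

end

lemma reiteratively_hypercyclic_backward_shift:
  "reiteratively_hypercyclic
    (backward_shift weight :: 'a::{real_normed_field, second_countable_topology} c0 \<Rightarrow> 'a c0)"
proof -
  let ?T = "backward_shift weight :: 'a c0 \<Rightarrow> 'a c0"
  obtain z :: "nat \<Rightarrow> nat \<Rightarrow> 'a" where z: "\<And>k j. k < j \<Longrightarrow> z k j = 0" "\<And>k j. norm (z k j) \<le> 2 ^ k"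
    and dense: "\<And>(v :: 'a c0) e K. e > 0 \<Longrightarrow> \<exists>k\<ge>K. \<forall>j. norm (z k j - c0_nth v j) < e"
    using exists_dense_targets[where 'a = 'a] by blast
  interpret targets z by unfold_locales (use z in auto)
  have "upper_banach_density (return_set ?T recurrent_vector V) > 0" if V: "open V" "V \<noteq> {}" for V
  proof -
    obtain v e where e: "e > 0" and sub: "ball v e \<subseteq> V" using V open_contains_ball by blast
    obtain K where K: "(1/4::real) ^ K < e / 3" using real_arch_pow_inv[of "e/3" "1/4"] e by auto
    obtain k where k: "k \<ge> K" "\<And>j. norm (z k j - c0_nth v j) < e / 3"
      using dense[of "e/3" K v] e by auto
    have "(1/4::real) ^ k \<le> (1/4) ^ K" using k(1) by (intro power_decreasing) auto
    with K have small: "(1/4::real) ^ k < e / 3" by linarith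
    have hit: "block_start s + i * 8 ^ k \<in> return_set ?T recurrent_vector V" if "i \<le> s" "k = label s" for s i
    proof -
      let ?y = "(?T ^^ (block_start s + i * 8 ^ k)) recurrent_vector"
      have "norm (?y - v) \<le> 2 * e / 3"
      proof (rule c0_norm_le)
        fix c
        have "norm (c0_nth ?y c - c0_nth v c) \<le> norm (c0_nth ?y c - z k c) + norm (z k c - c0_nth v c)"
          using norm_triangle_ineq[of "c0_nth ?y c - z k c" "z k c - c0_nth v c"] by simp
        then show "norm (c0_nth (?y - v) c) \<le> 2 * e / 3"
          using orbit_approximates_target[OF that, of c] k(2)[of c] small
          by (simp add: minus_c0.rep_eq)
      qed
      then have "?y \<in> ball v e" using e by (simp add: dist_norm norm_minus_commute)
      then show ?thesis using sub by (auto simp: return_set_def)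
    qed
    show ?thesis
    proof (rule upper_banach_density_pos_if_progressions[of "8 ^ k"])
      fix l n :: nat
      obtain s where s: "s \<ge> max l n" "label s = k" using exists_late_block_with_label by blast
      have "n \<le> block_start s" using s(1) le_block_start[of s] by linarith
      moreover have "\<forall>i\<le>l. block_start s + i * 8 ^ k \<in> return_set ?T recurrent_vector V"
        using hit s by auto
      ultimately show "\<exists>N\<ge>n. \<forall>i\<le>l. N + i * 8 ^ k \<in> return_set ?T recurrent_vector V" by blast
    qed simp
  qed
  then show ?thesis unfolding reiteratively_hypercyclic_def by blast
qed

lemma backward_shift_weight_separates:
  defines "T \<equiv> backward_shift weight :: 'a::{real_normed_field, second_countable_topology} c0 \<Rightarrow> 'a c0"
  shows "is_weighted_shift weight T \<and> reiteratively_hypercyclic T \<and> \<not> U_frequently_hypercyclic T"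
  unfolding T_def
  using is_weighted_shift_backward_shift[OF weight_bounded weight_nonzero]
    reiteratively_hypercyclic_backward_shift not_U_frequently_hypercyclic_backward_shift
  by blast

theorem theorem17:
  shows "(\<exists>(w :: nat \<Rightarrow> real) (T :: real c0 \<Rightarrow> real c0). is_weighted_shift w T \<and>
            reiteratively_hypercyclic T \<and> \<not> U_frequently_hypercyclic T) \<and>
         (\<exists>(w :: nat \<Rightarrow> complex) (T :: complex c0 \<Rightarrow> complex c0). is_weighted_shift w T \<and>
            reiteratively_hypercyclic T \<and> \<not> U_frequently_hypercyclic T)"
  using backward_shift_weight_separates[where 'a = real]
    backward_shift_weight_separates[where 'a = complex] by blast

end
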